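(* Let $G$ be a finite weighted graph containing distinct vertices $v_1,v_2,v_3,v_4,u_1,u_3$ such that the edges incident to $u_1$ are exactly $u_1v_1$ (weight $1$), $u_1v_2$ (weight $b$), $u_1v_4$ (weight $a$), $u_1u_3$ (weight $e$), and the edges incident to $u_3$ are exactly $u_3v_3$ (weight $1$), $u_3v_2$ (weight $c$), $u_3v_4$ (weight $d$), $u_1u_3$ (weight $e$), where $a,b,c,d,e>0$. Put $\Delta=ac+bd$. Let $G'$ be obtained from $G$ by a diagonal spider move: delete $u_1,u_3$ and their incident edges, and add two new vertices $u_2,u_4$ with edges $u_2v_2$ and $u_4v_4$ of weight $1$, $v_1u_2$ of weight $\frac d\Delta$, $u_2v_3$ of weight $\frac a\Delta$, $v_3u_4$ of weight $\frac b\Delta$, $u_4v_1$ of weight $\frac c\Delta$, and $u_2u_4$ of weight $\frac e\Delta$. Then $$Z(G')=\frac1\Delta Z(G).$$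
   Context: A dimer cover (perfect matching) of a finite graph $G$ is a set $M$ of edges such that each vertex is incident to exactly one edge of $M$. Given edge weights $\mathrm{wt}$, the dimer partition function is $Z(G)=\sum_{M}\prod_{e\in M}\mathrm{wt}(e)$, summed over all dimer covers $M$ of $G$. The vertices $v_1,\dots,v_4$ may be connected arbitrarily to the rest of the graph, which is unchanged by the move. *)

theory Defs
  imports Complex_Main
begin

text \<open>
  Weighted graphs carry an explicit type of edges, so that parallel edges are allowed; loops are
  excluded. Edge weights are arbitrary real numbers.
\<close>

record ('v, 'e) wgraph =
  verts :: "'v set"
  edges :: "'e set"
  ends :: "'e \<Rightarrow> 'v set"
  wt :: "'e \<Rightarrow> real"

definition finite_wgraph :: "('v, 'e) wgraph \<Rightarrow> bool" where
  "finite_wgraph G \<longleftrightarrow>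
     finite (verts G) \<and> finite (edges G) \<and>
     (\<forall>f\<in>edges G. ends G f \<subseteq> verts G \<and> card (ends G f) = 2)"

definition incident_edges :: "('v, 'e) wgraph \<Rightarrow> 'v \<Rightarrow> 'e set" where
  "incident_edges G v = {f \<in> edges G. v \<in> ends G f}"

definition dimer_cover :: "('v, 'e) wgraph \<Rightarrow> 'e set \<Rightarrow> bool" where
  "dimer_cover G M \<longleftrightarrow> M \<subseteq> edges G \<and> (\<forall>v\<in>verts G. \<exists>!f. f \<in> M \<and> v \<in> ends G f)"

definition dimer_Z :: "('v, 'e) wgraph \<Rightarrow> real" where
  "dimer_Z G = (\<Sum>M | dimer_cover G M. \<Prod>f\<in>M. wt G f)"

text \<open>
  When the first components of the elements of \<open>S\<close> are pairwise distinct, the following says that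
  for each \<open>(X, w)\<close> in \<open>S\<close> there is exactly one edge with set of endpoints \<open>X\<close> among those incident
  to \<open>v\<close>, that its weight is \<open>w\<close>, and that no further edge is incident to \<open>v\<close>.
\<close>

definition incident_exactly :: "('v, 'e) wgraph \<Rightarrow> 'v \<Rightarrow> ('v set \<times> real) set \<Rightarrow> bool" where
  "incident_exactly G v S \<longleftrightarrow> bij_betw (\<lambda>f. (ends G f, wt G f)) (incident_edges G v) S"

definition delete_verts :: "('v, 'e) wgraph \<Rightarrow> 'v set \<Rightarrow> ('v, 'e) wgraph" where
  "delete_verts G U =
     \<lparr>verts = verts G - U, edges = {f \<in> edges G. ends G f \<inter> U = {}}, ends = ends G, wt = wt G\<rparr>"

text \<open>
  A new edge is labelled by the pair of its set of endpoints and its weight; the sum type keeps it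
  apart from the old edges, even from those with the same endpoints and weight.
\<close>

definition extend_graph ::
  "('v, 'e) wgraph \<Rightarrow> 'v set \<Rightarrow> ('v set \<times> real) set \<Rightarrow> ('v, 'e + 'v set \<times> real) wgraph" where
  "extend_graph G W S =
     \<lparr>verts = verts G \<union> W,
      edges = Inl ` edges G \<union> Inr ` S,
      ends = case_sum (ends G) fst,
      wt = case_sum (wt G) snd\<rparr>"

definition diagonal_spider_move ::
  "'v \<Rightarrow> 'v \<Rightarrow> 'v \<Rightarrow> 'v \<Rightarrow> 'v \<Rightarrow> 'v \<Rightarrow> 'v \<Rightarrow> 'v \<Rightarrow> real \<Rightarrow> real \<Rightarrow> real \<Rightarrow> real \<Rightarrow> real \<Rightarrow>
   ('v, 'e) wgraph \<Rightarrow> ('v, 'e + 'v set \<times> real) wgraph" where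
  "diagonal_spider_move v1 v2 v3 v4 u1 u3 u2 u4 a b c d e G =
     (let \<Delta> = a * c + b * d in
      extend_graph (delete_verts G {u1, u3}) {u2, u4}
        {({u2, v2}, 1), ({u4, v4}, 1),
         ({v1, u2}, d / \<Delta>), ({u2, v3}, a / \<Delta>),
         ({v3, u4}, b / \<Delta>), ({u4, v1}, c / \<Delta>),
         ({u2, u4}, e / \<Delta>)})"

end

theory Submission imports Defs begin

text \<open>
  In every dimer cover the two inner vertices (\<open>u1, u3\<close> in \<open>G\<close>, \<open>u2, u4\<close> in \<open>G'\<close>) are either matched to each other or to two distinct
  vertices of \<open>v1, \<dots>, v4\<close>. Sorting the covers of \<open>G\<close> and of \<open>G'\<close> by the set \<open>T\<close> of those
  \<open>vi\<close> that are matched inwards, both partition functions become linear combinations of the same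
  quantities: the partition functions of the unchanged part of the graph with \<open>T\<close> removed. It
  remains to compare coefficients. In \<open>G\<close> they are
  \<open>e\<close> for the empty set, \<open>c, d, b, a\<close> for \<open>{v1, v2}, {v1, v4}, {v2, v3}, {v3, v4}\<close>,
  \<open>1\<close> for \<open>{v1, v3}\<close>, and \<open>a * c + b * d = \<Delta>\<close> for \<open>{v2, v4}\<close>, which arises in two ways.
  In \<open>G'\<close> the two roles are exchanged: \<open>{v2, v4}\<close> arises in one way, with coefficient \<open>1\<close>, and
  \<open>{v1, v3}\<close> in two, with coefficient \<open>(b * d + a * c) / \<Delta>\<^sup>2 = 1 / \<Delta>\<close>; all other coefficients
  are visibly divided by \<open>\<Delta>\<close>.

  The sorting is a repeated expansion of the partition function along a vertex
  (\<open>dimer_Z_expand_vertex\<close> and \<open>dimer_Z_expand_two_vertices\<close>), and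
  \<open>dimer_Z_delete_extension\<close> says that the same graphs remain on both sides.
\<close>

section \<open>Expansion of the partition function along vertices\<close>

lemma finite_dimer_covers:
  "finite (edges K) \<Longrightarrow> finite {M. dimer_cover K M}"
  by (rule finite_subset[of _ "Pow (edges K)"]) (auto simp: dimer_cover_def)

lemma finite_incident_edges:
  "finite_wgraph K \<Longrightarrow> finite (incident_edges K v)"
  by (simp add: finite_wgraph_def incident_edges_def)

lemma finite_wgraph_delete_verts:
  "finite_wgraph K \<Longrightarrow> finite_wgraph (delete_verts K U)"
  by (auto simp: finite_wgraph_def delete_verts_def)

lemma delete_verts_delete_verts:
  "delete_verts (delete_verts K U) W = delete_verts K (U \<union> W)"
  by (auto simp: delete_verts_def)

text \<open>
  Both endpoints of a chosen edge are saturated by it, so the other edges of the cover avoid them,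
  and they cover precisely the remaining vertices.
\<close>

lemma dimer_covers_containing_edge:
  assumes "finite_wgraph K" "f \<in> edges K"
  shows "{M. dimer_cover K M \<and> f \<in> M} = insert f ` {N. dimer_cover (delete_verts K (ends K f)) N}"
proof (intro equalityI subsetI)
  fix M assume "M \<in> {M. dimer_cover K M \<and> f \<in> M}"
  then have M: "M \<subseteq> edges K" "\<And>v. v \<in> verts K \<Longrightarrow> \<exists>!g. g \<in> M \<and> v \<in> ends K g" "f \<in> M"
    by (auto simp: dimer_cover_def)
  have sub: "ends K f \<subseteq> verts K"
    using assms by (auto simp: finite_wgraph_def)
  have disj: "ends K g \<inter> ends K f = {}" if "g \<in> M" "g \<noteq> f" for g
    using M(2) sub M(3) that by blast
  have "dimer_cover (delete_verts K (ends K f)) (M - {f})"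
    unfolding dimer_cover_def
  proof (intro conjI ballI)
    show "M - {f} \<subseteq> edges (delete_verts K (ends K f))"
      using M(1) disj by (auto simp: delete_verts_def)
  next
    fix v assume "v \<in> verts (delete_verts K (ends K f))"
    then have "v \<in> verts K" "v \<notin> ends K f"
      by (auto simp: delete_verts_def)
    with M(2)[of v]
    show "\<exists>!g. g \<in> M - {f} \<and> v \<in> ends (delete_verts K (ends K f)) g"
      by (simp add: delete_verts_def) metis
  qed
  moreover have "M = insert f (M - {f})"
    using M(3) by auto
  ultimately show "M \<in> insert f ` {N. dimer_cover (delete_verts K (ends K f)) N}"
    by blast
next
  fix M assume "M \<in> insert f ` {N. dimer_cover (delete_verts K (ends K f)) N}"
  then obtain N where N: "M = insert f N" "dimer_cover (delete_verts K (ends K f)) N"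
    by auto
  then have sub: "N \<subseteq> edges K" and disj: "\<And>g. g \<in> N \<Longrightarrow> ends K g \<inter> ends K f = {}"
    and ex1: "\<And>v. v \<in> verts K - ends K f \<Longrightarrow> \<exists>!g. g \<in> N \<and> v \<in> ends K g"
    by (auto simp: dimer_cover_def delete_verts_def)
  have "\<exists>!g. g \<in> M \<and> v \<in> ends K g" if "v \<in> verts K" for v
  proof (cases "v \<in> ends K f")
    case True
    then show ?thesis
      using disj unfolding N(1) by blast
  next
    case False
    then show ?thesis
      using ex1[of v] that unfolding N(1) by blast
  qed
  then show "M \<in> {M. dimer_cover K M \<and> f \<in> M}"
    using sub assms(2) by (auto simp: dimer_cover_def N(1))
qed

text \<open>
  Every dimer cover contains exactly one of the edges at \<open>v\<close>, so the covers are classified by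
  this edge.
\<close>

lemma dimer_Z_expand_vertex:
  assumes K: "finite_wgraph K" and v: "v \<in> verts K"
  shows "dimer_Z K = (\<Sum>f\<in>incident_edges K v. wt K f * dimer_Z (delete_verts K (ends K f)))"
proof -
  have fin: "finite (edges K)"
    using K by (simp add: finite_wgraph_def)
  let ?C = "\<lambda>f. {M. dimer_cover K M \<and> f \<in> M}"
  have union: "{M. dimer_cover K M} = (\<Union>f\<in>incident_edges K v. ?C f)"
    using v by (fastforce simp: dimer_cover_def incident_edges_def)
  have disj: "?C f \<inter> ?C g = {}"
    if "f \<in> incident_edges K v" "g \<in> incident_edges K v" "f \<noteq> g" for f g
    using that v by (auto simp: dimer_cover_def incident_edges_def)
  have part: "(\<Sum>M\<in>?C f. \<Prod>g\<in>M. wt K g) = wt K f * dimer_Z (delete_verts K (ends K f))"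
    if "f \<in> incident_edges K v" for f
  proof -
    let ?D = "{N. dimer_cover (delete_verts K (ends K f)) N}"
    have f: "f \<in> edges K" "v \<in> ends K f"
      using that by (auto simp: incident_edges_def)
    have notin: "f \<notin> N" and finN: "finite N" if "N \<in> ?D" for N
      using that f fin by (auto simp: dimer_cover_def delete_verts_def intro: finite_subset)
    have "inj_on (insert f) ?D"
      using notin by (intro inj_onI) (metis insert_ident)
    then have "(\<Sum>M\<in>?C f. \<Prod>g\<in>M. wt K g) = (\<Sum>N\<in>?D. \<Prod>g\<in>insert f N. wt K g)"
      unfolding dimer_covers_containing_edge[OF K f(1)] by (simp add: sum.reindex)
    also have "\<dots> = (\<Sum>N\<in>?D. wt K f * (\<Prod>g\<in>N. wt K g))"
      using notin finN by (intro sum.cong) auto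
    also have "\<dots> = wt K f * dimer_Z (delete_verts K (ends K f))"
      by (simp add: dimer_Z_def sum_distrib_left) (simp add: delete_verts_def)
    finally show ?thesis .
  qed
  have "dimer_Z K = (\<Sum>f\<in>incident_edges K v. \<Sum>M\<in>?C f. \<Prod>g\<in>M. wt K g)"
    unfolding dimer_Z_def union
    using disj finite_incident_edges[OF K] finite_dimer_covers[OF fin]
    by (intro sum.UNION_disjoint) auto
  then show ?thesis
    using part by simp
qed

lemma dimer_Z_expand_incident_exactly:
  assumes "finite_wgraph K" "v \<in> verts K" "incident_exactly K v S"
  shows "dimer_Z K = (\<Sum>(X, w)\<in>S. w * dimer_Z (delete_verts K X))"
  using sum.reindex_bij_betw[OF assms(3)[unfolded incident_exactly_def],
      of "\<lambda>(X, w). w * dimer_Z (delete_verts K X)"]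
  by (simp add: dimer_Z_expand_vertex[OF assms(1,2)])

lemma incident_exactly_delete_verts:
  assumes "incident_exactly K v S"
  shows "incident_exactly (delete_verts K U) v {(X, w)\<in>S. X \<inter> U = {}}"
  using assms
  by (auto simp: incident_exactly_def bij_betw_def incident_edges_def delete_verts_def inj_on_def)

text \<open>
  After expanding along \<open>p\<close>, each resulting graph that still contains \<open>q\<close> is expanded along \<open>q\<close>;
  only those edges at \<open>q\<close> are left that are disjoint from the edge chosen at \<open>p\<close>.
\<close>

lemma dimer_Z_expand_two_vertices:
  assumes K: "finite_wgraph K" and pq: "p \<in> verts K" "q \<in> verts K"
    and S: "incident_exactly K p S" and T: "incident_exactly K q T"
  shows "dimer_Z K = (\<Sum>(X, w)\<in>S. w *
    (if q \<in> X then dimer_Z (delete_verts K X)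
     else \<Sum>(Y, z)\<in>T. if Y \<inter> X = {} then z * dimer_Z (delete_verts K (X \<union> Y)) else 0))"
proof -
  have "finite T"
    using T finite_incident_edges[OF K] bij_betw_finite unfolding incident_exactly_def by blast
  have "dimer_Z (delete_verts K X) =
      (\<Sum>(Y, z)\<in>T. if Y \<inter> X = {} then z * dimer_Z (delete_verts K (X \<union> Y)) else 0)"
    if "q \<notin> X" for X
  proof -
    have "q \<in> verts (delete_verts K X)"
      using pq that by (simp add: delete_verts_def)
    then have "dimer_Z (delete_verts K X) =
        (\<Sum>(Y, z)\<in>{(Y, z)\<in>T. Y \<inter> X = {}}. z * dimer_Z (delete_verts K (X \<union> Y)))"
      by (subst dimer_Z_expand_incident_exactly[OF finite_wgraph_delete_verts[OF K] _
            incident_exactly_delete_verts[OF T]])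
        (simp_all add: delete_verts_delete_verts)
    also have "\<dots> = (\<Sum>(Y, z)\<in>T. if Y \<inter> X = {} then z * dimer_Z (delete_verts K (X \<union> Y)) else 0)"
      using \<open>finite T\<close> by (intro sum.mono_neutral_cong_left) (auto split: if_splits)
    finally show ?thesis .
  qed
  then show ?thesis
    unfolding dimer_Z_expand_incident_exactly[OF K pq(1) S]
    by (intro sum.cong) auto
qed

section \<open>Graphs with added vertices and edges\<close>

lemma finite_wgraph_extend_graph:
  assumes "finite_wgraph H" "finite W" "finite S"
    and "\<And>X w. (X, w) \<in> S \<Longrightarrow> X \<subseteq> verts H \<union> W \<and> card X = 2"
  shows "finite_wgraph (extend_graph H W S)"
  using assms by (fastforce simp: finite_wgraph_def extend_graph_def)

lemma incident_exactly_extend_graph: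
  assumes "finite_wgraph H" "v \<notin> verts H"
  shows "incident_exactly (extend_graph H W S) v {(X, w)\<in>S. v \<in> X}"
proof -
  have "incident_edges (extend_graph H W S) v = Inr ` {(X, w)\<in>S. v \<in> X}"
    using assms by (fastforce simp: incident_edges_def extend_graph_def finite_wgraph_def)
  then show ?thesis
    by (auto simp: incident_exactly_def bij_betw_def extend_graph_def inj_on_def image_image)
qed

text \<open>
  Extending a graph tags its edges with \<open>Inl\<close>; such a renaming has to be undone before the
  remainders of \<open>G\<close> and \<open>G'\<close>, whose edges have different types, can be compared.
\<close>

lemma dimer_Z_relabel_edges:
  assumes h: "inj_on h (edges K)" "edges K' = h ` edges K" and verts: "verts K' = verts K"
    and ends: "\<And>f. f \<in> edges K \<Longrightarrow> ends K' (h f) = ends K f"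
    and wt: "\<And>f. f \<in> edges K \<Longrightarrow> wt K' (h f) = wt K f"
  shows "dimer_Z K' = dimer_Z K"
proof -
  have cover: "dimer_cover K' (h ` M) \<longleftrightarrow> dimer_cover K M" if M: "M \<subseteq> edges K" for M
  proof -
    have "(\<exists>!f. f \<in> h ` M \<and> v \<in> ends K' f) \<longleftrightarrow> (\<exists>!f. f \<in> M \<and> v \<in> ends K f)" for v
    proof
      assume "\<exists>!f. f \<in> h ` M \<and> v \<in> ends K' f"
      then show "\<exists>!f. f \<in> M \<and> v \<in> ends K f"
        using ends M inj_onD[OF h(1)] by (smt (verit, best) image_iff subsetD)
    next
      assume "\<exists>!f. f \<in> M \<and> v \<in> ends K f"
      then show "\<exists>!f. f \<in> h ` M \<and> v \<in> ends K' f"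
        using ends M by (smt (verit, best) image_iff subsetD)
    qed
    then show ?thesis
      using M by (auto simp: dimer_cover_def h(2) verts)
  qed
  have "bij_betw ((`) h) {M. dimer_cover K M} {M. dimer_cover K' M}"
    unfolding bij_betw_def
  proof
    show "inj_on ((`) h) {M. dimer_cover K M}"
      using inj_on_image_Pow[OF h(1)] by (rule inj_on_subset) (auto simp: dimer_cover_def)
    have "\<exists>M. dimer_cover K M \<and> N = h ` M" if "dimer_cover K' N" for N
    proof -
      from that have "N \<subseteq> h ` edges K"
        by (simp add: dimer_cover_def h(2))
      then obtain M where "M \<subseteq> edges K" "N = h ` M"
        by (auto simp: subset_image_iff)
      then show ?thesis
        using cover that by auto
    qed
    moreover have "dimer_cover K' (h ` M)" if "dimer_cover K M" for M
      using cover[of M] that by (auto simp: dimer_cover_def[of K])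
    ultimately show "(`) h ` {M. dimer_cover K M} = {M. dimer_cover K' M}"
      by blast
  qed
  then have "dimer_Z K' = (\<Sum>M | dimer_cover K M. \<Prod>f\<in>h ` M. wt K' f)"
    unfolding dimer_Z_def by (simp add: sum.reindex_bij_betw)
  also have "\<dots> = dimer_Z K"
    unfolding dimer_Z_def
  proof (rule sum.cong)
    fix M assume "M \<in> {M. dimer_cover K M}"
    then have M: "M \<subseteq> edges K"
      by (simp add: dimer_cover_def)
    then have "inj_on h M"
      using h(1) inj_on_subset by blast
    then show "(\<Prod>f\<in>h ` M. wt K' f) = (\<Prod>f\<in>M. wt K f)"
      using M wt by (auto simp: prod.reindex intro!: prod.cong)
  qed simp
  finally show ?thesis .
qed

text \<open>
  Deleting the added vertices, possibly together with old ones, destroys every added edge, so that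
  only the old graph is left.
\<close>

lemma dimer_Z_delete_extension:
  assumes "W \<subseteq> U" "W \<inter> verts H = {}" "\<And>X w. (X, w) \<in> S \<Longrightarrow> X \<inter> W \<noteq> {}" "finite_wgraph H"
  shows "dimer_Z (delete_verts (extend_graph H W S) U) = dimer_Z (delete_verts H (U - W))"
proof (rule dimer_Z_relabel_edges[where h = Inl])
  have "ends H f \<inter> W = {}" if "f \<in> edges H" for f
    using assms(2,4) that by (auto simp: finite_wgraph_def)
  then have "ends H f \<inter> U = {} \<longleftrightarrow> ends H f \<inter> (U - W) = {}" if "f \<in> edges H" for f
    using that by blast
  then show "edges (delete_verts (extend_graph H W S) U) = Inl ` edges (delete_verts H (U - W))"
    using assms(1,3) by (fastforce simp: delete_verts_def extend_graph_def)
qed (use assms in \<open>auto simp: delete_verts_def extend_graph_def\<close>)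

section \<open>The diagonal spider move\<close>

theorem lemma41:
  fixes G :: "('v, 'e) wgraph"
    and G' :: "('v, 'e + 'v set \<times> real) wgraph"
    and v1 v2 v3 v4 u1 u3 u2 u4 :: 'v
    and a b c d e \<Delta> :: real
  assumes "finite_wgraph G"
    and "{v1, v2, v3, v4, u1, u3} \<subseteq> verts G"
    and "distinct [v1, v2, v3, v4, u1, u3]"
    and "a > 0" "b > 0" "c > 0" "d > 0" "e > 0"
    and "incident_exactly G u1 {({u1, v1}, 1), ({u1, v2}, b), ({u1, v4}, a), ({u1, u3}, e)}"
    and "incident_exactly G u3 {({u3, v3}, 1), ({u3, v2}, c), ({u3, v4}, d), ({u1, u3}, e)}"
    and "\<Delta> = a * c + b * d"
    and "u2 \<notin> verts G" "u4 \<notin> verts G" "u2 \<noteq> u4"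
    and "G' = diagonal_spider_move v1 v2 v3 v4 u1 u3 u2 u4 a b c d e G"
  shows "dimer_Z G' = 1 / \<Delta> * dimer_Z G"
proof -
  define H where "H = delete_verts G {u1, u3}"
  \<comment> \<open>The common quantities: the unchanged part without the vertices \<open>T\<close> matched inwards.\<close>
  define Z where "Z T = dimer_Z (delete_verts H T)" for T
  define S where "S = {({u2, v2}, 1), ({u4, v4}, 1),
         ({v1, u2}, d / \<Delta>), ({u2, v3}, a / \<Delta>),
         ({v3, u4}, b / \<Delta>), ({u4, v1}, c / \<Delta>),
         ({u2, u4}, e / \<Delta>)}"
  have vertsG: "v1 \<in> verts G" "v2 \<in> verts G" "v3 \<in> verts G" "v4 \<in> verts G"
    "u1 \<in> verts G" "u3 \<in> verts G"
    using assms(2) by auto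
  have old: "v1 \<noteq> v2" "v1 \<noteq> v3" "v1 \<noteq> v4" "v1 \<noteq> u1" "v1 \<noteq> u3" "v2 \<noteq> v3" "v2 \<noteq> v4" "v2 \<noteq> u1"
    "v2 \<noteq> u3" "v3 \<noteq> v4" "v3 \<noteq> u1" "v3 \<noteq> u3" "v4 \<noteq> u1" "v4 \<noteq> u3" "u1 \<noteq> u3"
    using assms(3) by auto
  have new: "u2 \<noteq> v1" "u2 \<noteq> v2" "u2 \<noteq> v3" "u2 \<noteq> v4" "u2 \<noteq> u1" "u2 \<noteq> u3"
    "u4 \<noteq> v1" "u4 \<noteq> v2" "u4 \<noteq> v3" "u4 \<noteq> v4" "u4 \<noteq> u1" "u4 \<noteq> u3" "u2 \<noteq> u4"
    using vertsG assms(12-14) by auto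
  note neq = old old[symmetric] new new[symmetric]
  have G': "G' = extend_graph H {u2, u4} S"
    using assms(11,15) by (simp add: diagonal_spider_move_def H_def S_def Let_def)
  have H: "finite_wgraph H"
    using assms(1) by (simp add: H_def finite_wgraph_delete_verts)
  have vertsH: "{v1, v2, v3, v4} \<subseteq> verts H" "u2 \<notin> verts H" "u4 \<notin> verts H"
    using vertsG neq assms(12,13) by (auto simp: H_def delete_verts_def)

  have Z_G: "dimer_Z (delete_verts G U) = Z (U - {u1, u3})" if "{u1, u3} \<subseteq> U" for U
    using that by (simp add: Z_def H_def delete_verts_delete_verts insert_absorb)
  have Z_G': "dimer_Z (delete_verts G' U) = Z (U - {u2, u4})" if "{u2, u4} \<subseteq> U" for U
    unfolding G' Z_def
    by (rule dimer_Z_delete_extension) (use that vertsH H in \<open>auto simp: S_def\<close>)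

  have pairs: "{v2, v1} = {v1, v2}" "{v3, v1} = {v1, v3}" "{v4, v1} = {v1, v4}"
    "{v3, v2} = {v2, v3}" "{v4, v2} = {v2, v4}" "{v4, v3} = {v3, v4}"
    by auto

  have G_sum: "dimer_Z G = e * Z {} + Z {v1, v3} + c * Z {v1, v2} + d * Z {v1, v4}
      + b * Z {v2, v3} + a * Z {v3, v4} + \<Delta> * Z {v2, v4}"
    using neq
    by (subst dimer_Z_expand_two_vertices[OF assms(1) vertsG(5,6) assms(9,10)])
      (simp add: doubleton_eq_iff Z_G insert_Diff_if pairs, simp add: assms(11) algebra_simps)

  have fin': "finite_wgraph G'"
    unfolding G'
    by (rule finite_wgraph_extend_graph) (use H vertsH neq in \<open>auto simp: S_def\<close>)
  have verts': "u2 \<in> verts G'" "u4 \<in> verts G'"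
    by (auto simp: G' extend_graph_def)
  have at_u2: "incident_exactly G' u2
      {({u2, v2}, 1), ({v1, u2}, d / \<Delta>), ({u2, v3}, a / \<Delta>), ({u2, u4}, e / \<Delta>)}"
  proof -
    have "{(X, w)\<in>S. u2 \<in> X} =
        {({u2, v2}, 1), ({v1, u2}, d / \<Delta>), ({u2, v3}, a / \<Delta>), ({u2, u4}, e / \<Delta>)}"
      using neq by (auto simp: S_def)
    then show ?thesis
      using incident_exactly_extend_graph[OF H vertsH(2), of "{u2, u4}" S] by (simp add: G')
  qed
  have at_u4: "incident_exactly G' u4
      {({u4, v4}, 1), ({v3, u4}, b / \<Delta>), ({u4, v1}, c / \<Delta>), ({u2, u4}, e / \<Delta>)}"
  proof -
    have "{(X, w)\<in>S. u4 \<in> X} =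
        {({u4, v4}, 1), ({v3, u4}, b / \<Delta>), ({u4, v1}, c / \<Delta>), ({u2, u4}, e / \<Delta>)}"
      using neq by (auto simp: S_def)
    then show ?thesis
      using incident_exactly_extend_graph[OF H vertsH(3), of "{u2, u4}" S] by (simp add: G')
  qed
  have G'_sum: "dimer_Z G' = e / \<Delta> * Z {} + (d / \<Delta> * (b / \<Delta>) + a / \<Delta> * (c / \<Delta>)) * Z {v1, v3}
      + c / \<Delta> * Z {v1, v2} + d / \<Delta> * Z {v1, v4}
      + b / \<Delta> * Z {v2, v3} + a / \<Delta> * Z {v3, v4} + Z {v2, v4}"
    using neq
    by (subst dimer_Z_expand_two_vertices[OF fin' verts' at_u2 at_u4])
      (simp add: doubleton_eq_iff Z_G' insert_Diff_if pairs, simp add: algebra_simps add_divide_distrib)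

  have "\<Delta> > 0"
    using assms(4-7,11) by (simp add: add_pos_pos)
  have "d / \<Delta> * (b / \<Delta>) + a / \<Delta> * (c / \<Delta>) = (a * c + b * d) / (\<Delta> * \<Delta>)"
    by (simp add: add_divide_distrib mult.commute)
  also have "\<dots> = 1 / \<Delta>"
    using \<open>\<Delta> > 0\<close> assms(11) by simp
  finally have v1_v3: "d / \<Delta> * (b / \<Delta>) + a / \<Delta> * (c / \<Delta>) = 1 / \<Delta>" .
  show ?thesis
    using \<open>\<Delta> > 0\<close> unfolding G_sum G'_sum v1_v3 by (simp add: field_simps)
qed

end
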